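(* Let $q=\operatorname{lcm}(q_1,\ldots,q_n)$ and let $\mathfrak{p}_1,\ldots,\mathfrak{p}_s$ be finitely many prime ideals of $R$ with $\mathfrak{p}_i\subsetneq\mathfrak{m}$ for all $i$. Then $$\mathfrak{m}_q\setminus\bigcup_{i=1}^s(\mathfrak{p}_i)_q\neq\emptyset .$$
   Context: $K$ is an infinite field of characteristic $0$ and $R=K[\mathbf{X_1},\ldots,\mathbf{X_n}]$ is a polynomial ring in the groups of variables $\mathbf{X_i}=(X_{i1},\ldots,X_{il_i})$, graded by $\deg X_{ij}=q_i$ for $j=1,\ldots,l_i$, where $0<q_1<q_2<\cdots<q_n$ are integers. $\mathfrak{m}$ is the graded maximal ideal generated by all the variables, and for an ideal $J$, $J_q=J\cap R_q$ denotes the set of its elements that are homogeneous of degree $q$ (including $0$). *)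

theory Defs
  imports "HOL-Algebra.Algebra" "HOL-Library.Poly_Mapping"
begin

text \<open>A monomial is a finitely supported exponent vector and a polynomial is a finitely
  supported family of coefficients indexed by monomials; multiplication on
  \<^typ>\<open>('v \<Rightarrow>\<^sub>0 nat) \<Rightarrow>\<^sub>0 'k\<close> is convolution.\<close>

type_synonym 'v monom = "'v \<Rightarrow>\<^sub>0 nat"
type_synonym ('v, 'k) mpoly = "'v monom \<Rightarrow>\<^sub>0 'k"

definition poly_var :: "'v \<Rightarrow> ('v, 'k::comm_ring_1) mpoly" where
  "poly_var v = Poly_Mapping.single (Poly_Mapping.single v 1) 1"

definition poly_vars :: "('v, 'k::comm_ring_1) mpoly \<Rightarrow> 'v set" where
  "poly_vars p = (\<Union>m \<in> Poly_Mapping.keys p. Poly_Mapping.keys m)"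

text \<open>The polynomial ring \<open>K[v | v \<in> V]\<close>, where \<open>K\<close> is the type \<^typ>\<open>'k\<close>.\<close>

definition mpoly_ring :: "'v set \<Rightarrow> ('v, 'k::comm_ring_1) mpoly ring" where
  "mpoly_ring V = \<lparr>carrier = {p. poly_vars p \<subseteq> V}, monoid.mult = (*), one = 1, ring.zero = 0, ring.add = (+)\<rparr>"

lemma mpoly_ring_cring: "cring (mpoly_ring V :: ('v, 'k::comm_ring_1) mpoly ring)"
proof -
  have add: "poly_vars (p + r) \<subseteq> V" if "poly_vars p \<subseteq> V" "poly_vars r \<subseteq> V"
    for p r :: "('v, 'k) mpoly"
    using that Poly_Mapping.keys_add[of p r] unfolding poly_vars_def by blast
  have mult: "poly_vars (p * r) \<subseteq> V" if "poly_vars p \<subseteq> V" "poly_vars r \<subseteq> V"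
    for p r :: "('v, 'k) mpoly"
  proof -
    have "Poly_Mapping.keys m \<subseteq> V" if m: "m \<in> Poly_Mapping.keys (p * r)" for m
    proof -
      obtain a b where "m = a + b" "a \<in> Poly_Mapping.keys p" "b \<in> Poly_Mapping.keys r"
        using m keys_mult[of p r] by blast
      then show ?thesis
        using \<open>poly_vars p \<subseteq> V\<close> \<open>poly_vars r \<subseteq> V\<close> Poly_Mapping.keys_add[of a b]
        unfolding poly_vars_def by blast
    qed
    then show ?thesis unfolding poly_vars_def by blast
  qed
  have neg: "\<exists>r. poly_vars r \<subseteq> V \<and> p + r = 0" if "poly_vars p \<subseteq> V" for p :: "('v, 'k) mpoly"
    using that by (intro exI[of _ "- p"]) (simp add: poly_vars_def)
  show ?thesis
    by (rule cringI; (rule abelian_groupI comm_monoidI)?)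
      (auto simp: mpoly_ring_def add mult neg algebra_simps subsetD[OF add] subsetD[OF mult]
        poly_vars_def[of 0] poly_vars_def[of 1])
qed

text \<open>The variable \<open>X\<^sub>i\<^sub>j\<close> is indexed by the pair \<open>(i, j)\<close>.\<close>

definition var_indices :: "nat \<Rightarrow> (nat \<Rightarrow> nat) \<Rightarrow> (nat \<times> nat) set" where
  "var_indices n l = {(i, j). i \<in> {1..n} \<and> j \<in> {1..l i}}"

definition graded_max_ideal :: "nat \<Rightarrow> (nat \<Rightarrow> nat) \<Rightarrow> (nat \<times> nat, 'k::comm_ring_1) mpoly set" where
  "graded_max_ideal n l = genideal (mpoly_ring (var_indices n l)) (poly_var ` var_indices n l)"

definition monom_deg :: "('v \<Rightarrow> nat) \<Rightarrow> 'v monom \<Rightarrow> nat" where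
  "monom_deg w m = (\<Sum>v \<in> Poly_Mapping.keys m. Poly_Mapping.lookup m v * w v)"

text \<open>The zero polynomial has no monomials, so it is homogeneous of every degree.\<close>

definition homogeneous :: "('v \<Rightarrow> nat) \<Rightarrow> nat \<Rightarrow> ('v, 'k::comm_ring_1) mpoly \<Rightarrow> bool" where
  "homogeneous w d p \<longleftrightarrow> (\<forall>m \<in> Poly_Mapping.keys p. monom_deg w m = d)"

definition hom_part :: "(nat \<Rightarrow> nat) \<Rightarrow> nat \<Rightarrow> (nat \<times> nat, 'k::comm_ring_1) mpoly set
    \<Rightarrow> (nat \<times> nat, 'k) mpoly set" where
  "hom_part q d J = {p \<in> J. homogeneous (\<lambda>(i, j). q i) d p}"

end

theory Submission
  imports Defs
begin

text \<open>Let \<open>Q\<close> be the least common multiple of the weights. The degree-\<open>Q\<close> part of \<open>\<mm>\<close> and the primes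
  themselves are subspaces of the \<open>K\<close>-vector space \<open>R\<close>, and a vector space over an infinite field is
  never a finite union of proper subspaces (\<open>subspace_avoidance\<close>). It therefore suffices that no
  single prime \<open>\<pp> \<subset> \<mm>\<close> contains all of \<open>\<mm>\<^sub>Q\<close> (\<open>hom_part_not_subset_prime\<close>). Such a \<open>\<pp>\<close> misses some
  variable \<open>X\<^sub>i\<^sub>j\<close>, since the variables generate \<open>\<mm>\<close>; being prime it also misses every power of
  \<open>X\<^sub>i\<^sub>j\<close>. As \<open>Q\<close> is a positive multiple of \<open>q\<^sub>i\<close>, the power with exponent \<open>Q / q\<^sub>i\<close> lies in \<open>\<mm>\<^sub>Q\<close>.\<close>

text \<open>Given \<open>a\<close> outside the subspaces treated so far and \<open>b\<close> outside the next one, the line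
  \<open>b + c a\<close> meets each old subspace at most once, and if \<open>a\<close> fails to avoid the new subspace, then
  the whole line avoids it. An infinite field leaves room for a good \<open>c\<close>.\<close>

lemma (in vector_space) subspace_avoidance:
  assumes "infinite (UNIV :: 'a set)" and "finite I" and W: "subspace W"
    and S: "\<And>i. i \<in> I \<Longrightarrow> subspace (S i)" and "\<And>i. i \<in> I \<Longrightarrow> \<not> W \<subseteq> S i"
  shows "\<exists>x \<in> W. \<forall>i \<in> I. x \<notin> S i"
  using assms(2, 4, 5)
proof (induction I rule: finite_induct)
  case empty
  show ?case using subspace_0[OF W] by blast
next
  case (insert k I)
  obtain a where a: "a \<in> W" "\<And>i. i \<in> I \<Longrightarrow> a \<notin> S i"
    using insert.IH insert.prems by auto
  obtain b where b: "b \<in> W" "b \<notin> S k"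
    using insert.prems(2) by auto
  show ?case
  proof (cases "a \<in> S k")
    case False
    then show ?thesis using a by auto
  next
    case True
    have finite_bad: "finite {c. b + c *s a \<in> S i}" if i: "i \<in> I" for i
    proof -
      have Si: "subspace (S i)" using insert.prems(1) i by simp
      have "c = d" if c: "b + c *s a \<in> S i" and d: "b + d *s a \<in> S i" for c d
      proof (rule ccontr)
        assume "c \<noteq> d"
        have "(b + c *s a) - (b + d *s a) = (c - d) *s a"
          by (simp add: scale_left_diff_distrib)
        then have "(c - d) *s a \<in> S i"
          using subspace_diff[OF Si c d] by simp
        then have "inverse (c - d) *s ((c - d) *s a) \<in> S i"
          by (rule subspace_scale[OF Si])
        then have "a \<in> S i" using \<open>c \<noteq> d\<close> by simp
        then show False using a(2) i by blast
      qed
      then have "\<exists>c. {c. b + c *s a \<in> S i} \<subseteq> {c}" by blast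
      then show ?thesis by (meson finite.simps finite_subset)
    qed
    then have "finite (\<Union>i \<in> I. {c. b + c *s a \<in> S i})"
      using \<open>finite I\<close> by blast
    then obtain c where c: "\<And>i. i \<in> I \<Longrightarrow> b + c *s a \<notin> S i"
      using ex_new_if_finite[OF assms(1)] by blast
    have Sk: "subspace (S k)" using insert.prems(1) by simp
    have "b + c *s a \<notin> S k"
      using subspace_diff[OF Sk _ subspace_scale[OF Sk True, of c], of "b + c *s a"] b(2) by auto
    moreover have "b + c *s a \<in> W"
      using a(1) b(1) W by (intro subspace_add subspace_scale)
    ultimately show ?thesis using c by auto
  qed
qed

definition poly_scale :: "'k::comm_ring_1 \<Rightarrow> ('v, 'k) mpoly \<Rightarrow> ('v, 'k) mpoly" where
  "poly_scale c p = Poly_Mapping.single 0 c * p"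

interpretation poly: vector_space "poly_scale :: 'k::field \<Rightarrow> ('v, 'k) mpoly \<Rightarrow> ('v, 'k) mpoly"
  by unfold_locales
    (simp_all add: poly_scale_def single_add distrib_left distrib_right mult_single
      mult.assoc [symmetric])

lemma ideal_imp_subspace:
  fixes J :: "('v, 'k::field) mpoly set"
  assumes "ideal J (mpoly_ring V)"
  shows "poly.subspace J"
proof -
  interpret ideal J "mpoly_ring V" by fact
  have "Poly_Mapping.single 0 c \<in> carrier (mpoly_ring V)" for c :: 'k
    by (simp add: mpoly_ring_def poly_vars_def)
  then have "poly_scale c x \<in> J" if "x \<in> J" for c x
    using I_l_closed[OF that] by (auto simp: mpoly_ring_def poly_scale_def)
  then show ?thesis
    using additive_subgroup.zero_closed[OF is_additive_subgroup]
      additive_subgroup.a_closed[OF is_additive_subgroup]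
    by (auto simp: poly.subspace_def mpoly_ring_def)
qed

lemma homogeneous_subspace: "poly.subspace {p :: ('v, 'k::field) mpoly. homogeneous w d p}"
proof -
  have "homogeneous w d (p + r)" if "homogeneous w d p" "homogeneous w d r"
    for p r :: "('v, 'k) mpoly"
    using that Poly_Mapping.keys_add[of p r] unfolding homogeneous_def by blast
  moreover have "homogeneous w d (poly_scale c p)" if "homogeneous w d p"
    for c and p :: "('v, 'k) mpoly"
    using that keys_mult[of "Poly_Mapping.single 0 c" p]
    unfolding homogeneous_def poly_scale_def by (auto split: if_splits)
  ultimately show ?thesis
    by (auto simp: poly.subspace_def homogeneous_def[of _ _ 0])
qed

lemma hom_part_subspace:
  assumes "ideal J (mpoly_ring V)"
  shows "poly.subspace (hom_part q d (J :: (nat \<times> nat, 'k::field) mpoly set))"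
  using poly.subspace_inter[OF ideal_imp_subspace[OF assms] homogeneous_subspace]
  by (simp add: hom_part_def Int_def)

lemma (in primeideal) pow_notin:
  assumes "a \<in> carrier R" "a \<notin> I"
  shows "a [^] (k :: nat) \<notin> I"
proof (induction k)
  case 0
  show ?case using I_notcarr one_imp_carrier by auto
next
  case (Suc k)
  then show ?case using I_prime[of "a [^] k" a] assms by auto
qed

lemma poly_var_carrier: "v \<in> V \<Longrightarrow> (poly_var v :: ('v, 'k::comm_ring_1) mpoly) \<in> carrier (mpoly_ring V)"
  by (simp add: mpoly_ring_def poly_vars_def poly_var_def)

lemma poly_var_pow:
  "(poly_var v :: ('v, 'k::comm_ring_1) mpoly) [^]\<^bsub>mpoly_ring V\<^esub> k
    = Poly_Mapping.single (Poly_Mapping.single v k) 1"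
  by (induction k)
    (simp_all add: mpoly_ring_def poly_var_def mult_single single_add [symmetric] add.commute
      nat_pow_def)

lemma homogeneous_poly_var_pow:
  "homogeneous w (k * w v) ((poly_var v :: ('v, 'k::comm_ring_1) mpoly) [^]\<^bsub>mpoly_ring V\<^esub> k)"
  by (simp add: poly_var_pow homogeneous_def monom_deg_def)

lemma graded_max_ideal_ideal:
  "ideal (graded_max_ideal n l :: (nat \<times> nat, 'k::comm_ring_1) mpoly set)
    (mpoly_ring (var_indices n l))"
  unfolding graded_max_ideal_def
  by (intro ring.genideal_ideal cring.axioms(1) mpoly_ring_cring image_subsetI poly_var_carrier)

text \<open>Nothing tells which variable \<open>X\<^sub>i\<^sub>j\<close> lies outside the prime, so \<open>Q\<close> has to be a common multiple
  of all the weights for one of its powers to have degree \<open>Q\<close>; \<open>0 < Q\<close> makes the exponent positive,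
  which puts that power in \<open>\<mm>\<close>.\<close>

lemma hom_part_not_subset_prime:
  fixes P :: "(nat \<times> nat, 'k::comm_ring_1) mpoly set"
  assumes "primeideal P (mpoly_ring (var_indices n l))"
    and "P \<subset> graded_max_ideal n l"
    and "0 < Q" and "\<And>i. i \<in> {1..n} \<Longrightarrow> q i dvd Q"
  shows "\<not> hom_part q Q (graded_max_ideal n l) \<subseteq> P"
proof -
  let ?R = "mpoly_ring (var_indices n l) :: (nat \<times> nat, 'k) mpoly ring"
  interpret primeideal P ?R by fact
  interpret m: ideal "graded_max_ideal n l" ?R by (rule graded_max_ideal_ideal)
  have "\<not> poly_var ` var_indices n l \<subseteq> P"
    using genideal_minimal[OF is_ideal] assms(2) unfolding graded_max_ideal_def by blast
  then obtain i j where v: "(i, j) \<in> var_indices n l" "poly_var (i, j) \<notin> P"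
    by auto
  let ?x = "poly_var (i, j) :: (nat \<times> nat, 'k) mpoly"
  have x: "?x \<in> carrier ?R" using v(1) by (rule poly_var_carrier)
  have "q i dvd Q" using v(1) assms(4) by (simp add: var_indices_def)
  then obtain k where Q: "Q = k * q i" by (metis dvdE mult.commute)
  with \<open>0 < Q\<close> obtain k' where k: "k = Suc k'" by (cases k) auto
  have "?x \<in> graded_max_ideal n l"
    unfolding graded_max_ideal_def
    by (rule subsetD[OF genideal_self]) (use v(1) in \<open>auto intro: poly_var_carrier\<close>)
  then have "?x [^]\<^bsub>?R\<^esub> k \<in> graded_max_ideal n l"
    using x by (simp add: k m.I_l_closed)
  moreover have "homogeneous (\<lambda>(i, j). q i) Q (?x [^]\<^bsub>?R\<^esub> k)"
    using homogeneous_poly_var_pow[of "\<lambda>(i, j). q i" k "(i, j)"] Q by simp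
  ultimately have "?x [^]\<^bsub>?R\<^esub> k \<in> hom_part q Q (graded_max_ideal n l)"
    by (simp add: hom_part_def)
  then show ?thesis using pow_notin[OF x v(2)] by blast
qed

theorem lemma2p1:
  fixes n s :: nat
    and l q :: "nat \<Rightarrow> nat"
    and P :: "nat \<Rightarrow> (nat \<times> nat, 'k::field_char_0) mpoly set"
  assumes "1 \<le> n"
    and "0 < q 1"
    and "strict_mono_on {1..n} q"
    and "\<And>i. i \<in> {1..s} \<Longrightarrow> primeideal (P i) (mpoly_ring (var_indices n l))"
    and "\<And>i. i \<in> {1..s} \<Longrightarrow> P i \<subset> graded_max_ideal n l"
  shows "hom_part q (Lcm (q ` {1..n})) (graded_max_ideal n l)
      - (\<Union>i \<in> {1..s}. hom_part q (Lcm (q ` {1..n})) (P i)) \<noteq> {}"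
proof -
  let ?Q = "Lcm (q ` {1..n})"
  have "q i \<noteq> 0" if i: "i \<in> {1..n}" for i
    using strict_mono_onD[OF assms(3), of 1 i] i assms(1, 2) by (cases "i = 1") auto
  then have "0 \<notin> q ` {1..n}" by fastforce
  then have "0 < ?Q" by (simp add: Lcm_0_iff_nat neq0_conv [symmetric] del: neq0_conv)
  then have "\<not> hom_part q ?Q (graded_max_ideal n l) \<subseteq> P i" if "i \<in> {1..s}" for i
    using that assms(4, 5) by (intro hom_part_not_subset_prime) auto
  moreover have "poly.subspace (P i)" if "i \<in> {1..s}" for i
    using assms(4)[OF that] by (intro ideal_imp_subspace primeideal.axioms(1))
  ultimately have "\<exists>x \<in> hom_part q ?Q (graded_max_ideal n l). \<forall>i \<in> {1..s}. x \<notin> P i"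
    by (intro poly.subspace_avoidance infinite_UNIV_char_0
        hom_part_subspace[OF graded_max_ideal_ideal]) auto
  then show ?thesis by (auto simp: hom_part_def)
qed

end
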